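(* Let $G$ be a group. Let $V$ be a non-zero finite-dimensional vector space over $\mathbb{K}$, where $\mathbb{K} = \mathbb{R}$ or $\mathbb{K} = \mathbb{C}$. Then the following conditions are equivalent: (a) $G$ is locally finite; (b) every surjective linear cellular automaton $\tau \colon V^G \to V^G$ is injective.
   Context: A group is called locally finite if all its finitely generated subgroups are finite. Let $G$ be a group and $A$ a set. $A^G$ denotes the set of all maps $x \colon G \to A$ (configurations). The group $G$ acts on $A^G$ by $(gx)(h) = x(g^{-1}h)$ for all $x \in A^G$ and $g,h \in G$. A cellular automaton over the group $G$ and the alphabet $A$ is a map $\tau \colon A^G \to A^G$ for which there exist a finite subset $M \subset G$ (a memory set) and a map $\mu \colon A^M \to A$ (a local defining map) such that $\tau(x)(g) = \mu((g^{-1}x)|_M)$ for all $x \in A^G$ and $g \in G$, where $(\cdot)|_M \colon A^G \to A^M$ is the restriction map. If $V$ is a vector space over a field $\mathbb{K}$, a cellular automaton $\tau \colon V^G \to V^G$ is called a linear cellular automaton if $\tau$ is $\mathbb{K}$-linear with respect to the product (pointwise) vector space structure on $V^G$. *)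

theory Defs
  imports Complex_Main "HOL-Algebra.Generated_Groups"
begin

definition locally_finite :: "('g, 'm) monoid_scheme \<Rightarrow> bool" where
  "locally_finite G \<longleftrightarrow>
     (\<forall>H. subgroup H G \<and> (\<exists>S. finite S \<and> S \<subseteq> H \<and> generate G S = H) \<longrightarrow> finite H)"

(* Maps on a carrier set are represented by extensional functions, so that equality of
   configurations (and of patterns on a memory set) is equality of functions in HOL. *)
definition configs :: "('g, 'm) monoid_scheme \<Rightarrow> 'a set \<Rightarrow> ('g \<Rightarrow> 'a) set" where
  "configs G A = carrier G \<rightarrow>\<^sub>E A"

definition shift :: "('g, 'm) monoid_scheme \<Rightarrow> 'g \<Rightarrow> ('g \<Rightarrow> 'a) \<Rightarrow> ('g \<Rightarrow> 'a)" where
  "shift G g x = (\<lambda>h\<in>carrier G. x (inv\<^bsub>G\<^esub> g \<otimes>\<^bsub>G\<^esub> h))"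

(* The values of \<tau> outside configs G A are irrelevant and left unconstrained. *)
definition cellular_automaton ::
  "('g, 'm) monoid_scheme \<Rightarrow> 'a set \<Rightarrow> (('g \<Rightarrow> 'a) \<Rightarrow> ('g \<Rightarrow> 'a)) \<Rightarrow> bool" where
  "cellular_automaton G A \<tau> \<longleftrightarrow>
     \<tau> \<in> configs G A \<rightarrow> configs G A \<and>
     (\<exists>M \<mu>. finite M \<and> M \<subseteq> carrier G \<and> \<mu> \<in> (M \<rightarrow>\<^sub>E A) \<rightarrow> A \<and>
        (\<forall>x\<in>configs G A. \<forall>g\<in>carrier G.
           \<tau> x g = \<mu> (restrict (shift G (inv\<^bsub>G\<^esub> g) x) M)))"

(* The vector space V is given by a whole type with scalar multiplication sc; linearity refers to
   the pointwise operations on V^G. *)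
definition linear_cellular_automaton ::
  "('g, 'm) monoid_scheme \<Rightarrow> ('k::field \<Rightarrow> 'v::ab_group_add \<Rightarrow> 'v) \<Rightarrow>
     (('g \<Rightarrow> 'v) \<Rightarrow> ('g \<Rightarrow> 'v)) \<Rightarrow> bool" where
  "linear_cellular_automaton G sc \<tau> \<longleftrightarrow>
     cellular_automaton G UNIV \<tau> \<and>
     (\<forall>x\<in>configs G UNIV. \<forall>y\<in>configs G UNIV.
        \<tau> (\<lambda>g\<in>carrier G. x g + y g) = (\<lambda>g\<in>carrier G. \<tau> x g + \<tau> y g)) \<and>
     (\<forall>c. \<forall>x\<in>configs G UNIV.
        \<tau> (\<lambda>g\<in>carrier G. sc c (x g)) = (\<lambda>g\<in>carrier G. sc c (\<tau> x g)))"

end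

theory Submission
  imports Defs "HOL-Library.Function_Algebras"
begin

text \<open>If \<open>G\<close> is locally finite, a memory set \<open>M\<close> generates a finite subgroup \<open>H\<close>, and a linear
  cellular automaton splits as a product of linear endomorphisms of the finite-dimensional spaces
  \<open>V\<^sup>C\<close>, for \<open>C\<close> ranging over the left cosets of \<open>H\<close>.  Surjectivity passes to each factor, which is
  therefore injective.

  If \<open>G\<close> has an infinite subgroup generated by a finite set \<open>S\<close>, the Laplacian
  \<open>(\<Delta> x)(g) = |S| x(g) - (\<Sum>s\<in>S. x(g s))\<close> kills the constants.  It is the transpose of the
  operator \<open>p \<mapsto> |S| p(g) - (\<Sum>s\<in>S. p(g s\<^sup>-\<^sup>1))\<close> on finitely supported scalar functions, which is
  injective by the maximum principle.  A linear left inverse of the latter yields, by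
  transposition, preimages under \<open>\<Delta>\<close>, so that no topology on configurations is needed.\<close>

section \<open>Linear algebra in finitely spanned subspaces\<close>

lemma (in vector_space) inj_on_span_if_surj:
  assumes f: "Vector_Spaces.linear scale scale f" and "finite C" and surj: "f ` span C = span C"
  shows "inj_on f (span C)"
proof -
  interpret vector_space_pair scale scale by unfold_locales
  obtain B where B: "B \<subseteq> C" "independent B" "C \<subseteq> span B"
    by (rule maximal_independent_subset)
  have finB: "finite B" using B(1) \<open>finite C\<close> finite_subset by blast
  have spB: "span B = span C"
    using span_mono[OF B(1)] span_minimal[OF B(3) subspace_span] by (rule subset_antisym)
  have sp: "span (f ` B) = span B"
    using surj by (simp add: linear_span_image[OF f] spB)
  have bound: "card B \<le> card T" if "finite T" "f ` B \<subseteq> span T" for T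
  proof -
    have "B \<subseteq> span T"
      using span_superset[of B] span_minimal[OF that(2) subspace_span] sp by simp
    then show ?thesis using independent_span_bound[OF that(1) B(2)] by blast
  qed
  have "card B \<le> card (f ` B)" using bound[OF _ span_superset] finB by simp
  then have cardeq: "card (f ` B) = card B" using card_image_le[OF finB, of f] by simp
  then have injB: "inj_on f B" by (rule eq_card_imp_inj_on[OF finB])
  have "independent (f ` B)"
  proof
    assume "dependent (f ` B)"
    then obtain a where a: "a \<in> f ` B" "a \<in> span (f ` B - {a})"
      unfolding dependent_def by blast
    \<comment> \<open>Dropping a redundant \<open>a\<close> would leave a spanning set with fewer
      than \<open>card B\<close> elements.\<close>
    then have "f ` B \<subseteq> span (f ` B - {a})"
      using span_superset[of "f ` B - {a}"] by (metis insert_Diff insert_subset)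
    then have "card B \<le> card (f ` B - {a})" using bound finB by simp
    moreover have "card (f ` B - {a}) < card (f ` B)"
      using a(1) finB by (meson card_Diff1_less finite_imageI)
    ultimately show False using cardeq by simp
  qed
  then show ?thesis
    using linear_inj_on_span_independent_image[OF f _ injB] spB by simp
qed

lemma vector_space_fun:
  assumes "vector_space sc"
  shows "vector_space (\<lambda>c f x. sc c (f x))"
proof -
  interpret vector_space sc by fact
  show ?thesis
    by unfold_locales (auto simp: fun_eq_iff scale_right_distrib scale_left_distrib)
qed

lemma sum_fun_apply: "sum F A x = (\<Sum>a\<in>A. F a x)"
  for F :: "'a \<Rightarrow> 'b \<Rightarrow> 'c::comm_monoid_add"
  by (induction A rule: infinite_finite_induct) auto

text \<open>Functions vanishing off \<open>C\<close> model V^C; placing each basis vector of V at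
  each point of the finite set \<open>C\<close> gives the spanning set.\<close>

lemma finite_spanning_set_supported_on:
  fixes sc :: "'k::field \<Rightarrow> 'v::ab_group_add \<Rightarrow> 'v" and C :: "'g set"
  assumes "finite_dimensional_vector_space sc Basis" and "finite C"
  obtains T where "finite T"
    "module.span (\<lambda>c f x. sc c (f x)) T = {u. \<forall>g. g \<notin> C \<longrightarrow> u g = 0}"
proof -
  interpret V: finite_dimensional_vector_space sc Basis by fact
  interpret F: vector_space "\<lambda>c (f::'g \<Rightarrow> 'v) x. sc c (f x)"
    by (rule vector_space_fun[OF V.vector_space_axioms])
  define single where "single h v = (\<lambda>g. if g = h then v else 0)" for h :: 'g and v :: 'v
  define T where "T = (\<Union>h\<in>C. single h ` Basis)"
  have "finite T" unfolding T_def using assms(2) V.finite_Basis by blast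
  moreover have "F.span T = {u. \<forall>g. g \<notin> C \<longrightarrow> u g = 0}"
  proof
    show "F.span T \<subseteq> {u. \<forall>g. g \<notin> C \<longrightarrow> u g = 0}"
    proof (rule F.span_minimal)
      show "T \<subseteq> {u. \<forall>g. g \<notin> C \<longrightarrow> u g = 0}" by (auto simp: T_def single_def)
      show "F.subspace {u. \<forall>g. g \<notin> C \<longrightarrow> u g = 0}"
        by (auto simp: F.subspace_def)
    qed
    show "{u. \<forall>g. g \<notin> C \<longrightarrow> u g = 0} \<subseteq> F.span T"
    proof
      fix u :: "'g \<Rightarrow> 'v" assume "u \<in> {u. \<forall>g. g \<notin> C \<longrightarrow> u g = 0}"
      then have u: "u g = 0" if "g \<notin> C" for g using that by blast
      have lin: "Vector_Spaces.linear sc (\<lambda>c f x. sc c (f x)) (single h)" for h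
        by unfold_locales (auto simp: single_def fun_eq_iff)
      have "single h v \<in> F.span T" if "h \<in> C" for h v
      proof -
        interpret P: vector_space_pair sc "\<lambda>c (f::'g \<Rightarrow> 'v) x. sc c (f x)" by unfold_locales
        have "single h v \<in> single h ` V.span Basis" using V.span_Basis by simp
        also have "\<dots> = F.span (single h ` Basis)"
          by (simp add: P.linear_span_image[OF lin])
        also have "\<dots> \<subseteq> F.span T" by (rule F.span_mono) (use that T_def in blast)
        finally show ?thesis .
      qed
      then have "(\<Sum>h\<in>C. single h (u h)) \<in> F.span T" by (intro F.span_sum)
      also have "(\<Sum>h\<in>C. single h (u h)) = u"
        using u by (auto simp: fun_eq_iff sum_fun_apply single_def assms(2))
      finally show "u \<in> F.span T" .
    qed
  qed
  ultimately show thesis by (rule that)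
qed

section \<open>Locally finite groups: surjectivity implies injectivity\<close>

lemma surj_linear_cellular_automaton_inj:
  fixes G :: "('g, 'm) monoid_scheme" (structure)
    and sc :: "'k::field \<Rightarrow> 'v::ab_group_add \<Rightarrow> 'v"
  assumes "group G" and fd: "finite_dimensional_vector_space sc B"
    and lf: "locally_finite G"
    and lin: "linear_cellular_automaton G sc \<tau>"
    and surj: "\<tau> ` configs G UNIV = configs G UNIV"
  shows "inj_on \<tau> (configs G UNIV)"
proof -
  interpret group G by fact
  interpret V: finite_dimensional_vector_space sc B by fact
  interpret F: vector_space "\<lambda>c (f::'g \<Rightarrow> 'v) x. sc c (f x)"
    by (rule vector_space_fun[OF V.vector_space_axioms])
  obtain M \<mu> where M: "finite M" "M \<subseteq> carrier G" and
    \<tau>: "\<And>x g. x \<in> configs G UNIV \<Longrightarrow> g \<in> carrier G \<Longrightarrow>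
           \<tau> x g = \<mu> (restrict (shift G (inv g) x) M)"
    using lin unfolding linear_cellular_automaton_def cellular_automaton_def by metis
  have \<tau>_add: "\<tau> (\<lambda>g\<in>carrier G. x g + y g) = (\<lambda>g\<in>carrier G. \<tau> x g + \<tau> y g)"
    if "x \<in> configs G UNIV" "y \<in> configs G UNIV" for x y
    using lin that unfolding linear_cellular_automaton_def by blast
  have \<tau>_sc: "\<tau> (\<lambda>g\<in>carrier G. sc c (x g)) = (\<lambda>g\<in>carrier G. sc c (\<tau> x g))"
    if "x \<in> configs G UNIV" for c x
    using lin that unfolding linear_cellular_automaton_def by blast
  define H where "H = generate G M"
  have H: "subgroup H G" unfolding H_def by (rule generate_is_subgroup[OF M(2)])
  have MH: "M \<subseteq> H" unfolding H_def by (auto intro: generate.incl)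
  have "finite H"
    using lf H M MH unfolding locally_finite_def H_def by blast
  have res: "restrict u (carrier G) \<in> configs G UNIV" for u :: "'g \<Rightarrow> 'v"
    by (auto simp: configs_def)
  show ?thesis
  proof (rule inj_onI)
    fix x y assume x: "x \<in> configs G UNIV" and y: "y \<in> configs G UNIV" and eq: "\<tau> x = \<tau> y"
    have "x g0 = y g0" if g0: "g0 \<in> carrier G" for g0
    proof -
      define C where "C = g0 <# H"
      have CG: "C \<subseteq> carrier G"
        unfolding C_def using g0 H by (simp add: l_coset_subset_G subgroup.subset)
      have C_iff: "g \<in> C \<longleftrightarrow> (\<exists>h\<in>H. g = g0 \<otimes> h)" for g
        by (auto simp: C_def l_coset_def)
      have "finite C" unfolding C_def l_coset_def using \<open>finite H\<close> by simp
      have g0C: "g0 \<in> C"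
        unfolding C_iff using g0 subgroup.one_closed[OF H] by force
      \<comment> \<open>The local rule at \<open>g\<close> reads \<open>x (g \<otimes> m)\<close>
        for \<open>m\<close> in \<open>M\<close>, a right translate, so left cosets of
        \<open>H\<close> are closed under reading.\<close>
      have CM: "g \<otimes> m \<in> C" if gm: "g \<in> C" "m \<in> M" for g m
      proof -
        obtain h where h: "h \<in> H" "g = g0 \<otimes> h" using gm(1) unfolding C_iff by blast
        have "g \<otimes> m = g0 \<otimes> (h \<otimes> m)"
          using h g0 gm(2) M(2) subgroup.mem_carrier[OF H] by (auto simp: m_assoc)
        moreover have "h \<otimes> m \<in> H"
          by (rule subgroup.m_closed[OF H h(1) subsetD[OF MH gm(2)]])
        ultimately show ?thesis using C_iff by auto
      qed
      have local: "\<tau> z g = \<tau> z' g"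
        if "z \<in> configs G UNIV" "z' \<in> configs G UNIV" "g \<in> C" "\<And>h. h \<in> C \<Longrightarrow> z h = z' h"
        for z z' g
      proof -
        have g: "g \<in> carrier G" using that CG by blast
        have "restrict (shift G (inv g) z) M = restrict (shift G (inv g) z') M"
          using M(2) g CM[OF that(3)] that(4) by (intro restrict_ext) (auto simp: shift_def)
        then show ?thesis using \<tau> that(1,2) g by simp
      qed
      \<comment> \<open>\<open>W\<close> is V^C extended by 0 rather than by
        \<open>undefined\<close>, which makes it a subspace for the pointwise operations;
        \<open>f\<close> is the factor of \<open>\<tau>\<close> on \<open>C\<close>, with
        \<open>restrict\<close> passing back to configurations.\<close>
      define W where "W = {u :: 'g \<Rightarrow> 'v. \<forall>g. g \<notin> C \<longrightarrow> u g = 0}"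
      define f where "f u = (\<lambda>g. if g \<in> C then \<tau> (restrict u (carrier G)) g else 0)" for u
      have "Vector_Spaces.linear (\<lambda>c f x. sc c (f x)) (\<lambda>c f x. sc c (f x)) f"
      proof unfold_locales
        fix u v :: "'g \<Rightarrow> 'v"
        have "restrict (u + v) (carrier G) =
            (\<lambda>g\<in>carrier G. restrict u (carrier G) g + restrict v (carrier G) g)"
          by auto
        then have "\<tau> (restrict (u + v) (carrier G)) =
            (\<lambda>g\<in>carrier G. \<tau> (restrict u (carrier G)) g + \<tau> (restrict v (carrier G)) g)"
          by (simp only: \<tau>_add[OF res res])
        then show "f (u + v) = f u + f v"
          by (intro ext) (use CG in \<open>auto simp: f_def\<close>)
      next
        fix c and u :: "'g \<Rightarrow> 'v"
        have "restrict (\<lambda>x. sc c (u x)) (carrier G) =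
            (\<lambda>g\<in>carrier G. sc c (restrict u (carrier G) g))"
          by auto
        then have "\<tau> (restrict (\<lambda>x. sc c (u x)) (carrier G)) =
            (\<lambda>g\<in>carrier G. sc c (\<tau> (restrict u (carrier G)) g))"
          by (simp only: \<tau>_sc[OF res])
        then show "f (\<lambda>x. sc c (u x)) = (\<lambda>x. sc c (f u x))"
          by (intro ext) (use CG in \<open>auto simp: f_def\<close>)
      qed
      moreover obtain T where T: "finite T" "F.span T = W"
        unfolding W_def using finite_spanning_set_supported_on[OF fd \<open>finite C\<close>] by blast
      moreover have "f ` W = W"
      proof
        show "f ` W \<subseteq> W" by (auto simp: f_def W_def)
        show "W \<subseteq> f ` W"
        proof
          fix w assume w: "w \<in> W"
          obtain z where z: "z \<in> configs G UNIV" "\<tau> z = restrict w (carrier G)"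
            using surj res[of w] by (metis imageE)
          \<comment> \<open>The preimage \<open>z\<close> may be nonzero off \<open>C\<close>; by
            locality, cutting it off there does not change \<open>\<tau> z\<close> on
            \<open>C\<close>.\<close>
          define u where "u = (\<lambda>g. if g \<in> C then z g else 0)"
          have "\<tau> (restrict u (carrier G)) g = w g" if "g \<in> C" for g
          proof -
            have "\<tau> (restrict u (carrier G)) g = \<tau> z g"
              by (rule local[OF res z(1) that]) (use CG in \<open>auto simp: u_def\<close>)
            then show ?thesis using z(2) CG that by auto
          qed
          then have "f u = w" using w by (auto simp: f_def W_def fun_eq_iff)
          moreover have "u \<in> W" by (auto simp: u_def W_def)
          ultimately show "w \<in> f ` W" by blast
        qed
      qed
      ultimately have inj: "inj_on f W" using F.inj_on_span_if_surj[of f T] by simp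
      define r where "r z = (\<lambda>g. if g \<in> C then z g else 0)" for z :: "'g \<Rightarrow> 'v"
      \<comment> \<open>Cutting off to \<open>C\<close> intertwines \<open>\<tau>\<close> and
        \<open>f\<close>, so \<open>\<tau> x = \<tau> y\<close> gives
        \<open>f (r x) = f (r y)\<close>.\<close>
      have fr: "f (r z) = (\<lambda>g. if g \<in> C then \<tau> z g else 0)" if "z \<in> configs G UNIV" for z
      proof -
        have "\<tau> (restrict (r z) (carrier G)) g = \<tau> z g" if "g \<in> C" for g
          by (rule local[OF res \<open>z \<in> configs G UNIV\<close> that]) (use CG in \<open>auto simp: r_def\<close>)
        then show ?thesis by (auto simp: f_def)
      qed
      have "r x = r y"
        by (rule inj_onD[OF inj]) (use fr x y eq in \<open>auto simp: W_def r_def\<close>)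
      then show ?thesis using g0C by (metis r_def)
    qed
    with x y show "x = y" unfolding configs_def by (rule PiE_ext)
  qed
qed

section \<open>The Laplacian as a non-injective linear cellular automaton\<close>

text \<open>Right translations are used because they commute with the left shift action.
  \<open>S\<close> is not assumed symmetric, hence the inverses in the transpose.\<close>

definition laplacian ::
  "('g, 'm) monoid_scheme \<Rightarrow> ('k::field \<Rightarrow> 'v::ab_group_add \<Rightarrow> 'v) \<Rightarrow> 'g set \<Rightarrow> ('g \<Rightarrow> 'v) \<Rightarrow> 'g \<Rightarrow> 'v" where
  "laplacian G sc S x =
     (\<lambda>g\<in>carrier G. sc (of_nat (card S)) (x g) - (\<Sum>s\<in>S. x (g \<otimes>\<^bsub>G\<^esub> s)))"

lemma linear_cellular_automaton_laplacian:
  fixes G :: "('g, 'm) monoid_scheme" (structure)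
    and sc :: "'k::field \<Rightarrow> 'v::ab_group_add \<Rightarrow> 'v"
  assumes "group G" and "vector_space sc" and "finite S" and "S \<subseteq> carrier G"
  shows "linear_cellular_automaton G sc (laplacian G sc S)"
proof -
  interpret group G by fact
  interpret vector_space sc by fact
  have SG: "g \<otimes> s \<in> carrier G" if "g \<in> carrier G" "s \<in> S" for g s
    using that assms(4) by blast
  \<comment> \<open>The memory set is \<open>insert \<one> S\<close>: the entry at
    \<open>\<one>\<close> is \<open>x g\<close> and the entry at \<open>s\<close> is
    \<open>x (g \<otimes> s)\<close>.\<close>
  define \<mu> where "\<mu> p = sc (of_nat (card S)) (p \<one>) - (\<Sum>s\<in>S. p s)" for p :: "'g \<Rightarrow> _"
  have "laplacian G sc S x g = \<mu> (restrict (shift G (inv g) x) (insert \<one> S))"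
    if "g \<in> carrier G" for x g
  proof -
    have "(\<Sum>s\<in>S. restrict (shift G (inv g) x) (insert \<one> S) s) = (\<Sum>s\<in>S. x (g \<otimes> s))"
      using that assms(4) by (intro sum.cong) (auto simp: shift_def)
    then show ?thesis using that by (simp add: laplacian_def \<mu>_def shift_def)
  qed
  then have "cellular_automaton G UNIV (laplacian G sc S)"
    unfolding cellular_automaton_def
    using assms(3,4) by (intro conjI exI[of _ "insert \<one> S"] exI[of _ \<mu>])
      (auto simp: configs_def laplacian_def)
  moreover have "laplacian G sc S (\<lambda>g\<in>carrier G. x g + y g) =
      (\<lambda>g\<in>carrier G. laplacian G sc S x g + laplacian G sc S y g)" for x y
    unfolding laplacian_def
    by (rule restrict_ext) (simp add: SG scale_right_distrib sum.distrib)
  moreover have "laplacian G sc S (\<lambda>g\<in>carrier G. sc c (x g)) =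
      (\<lambda>g\<in>carrier G. sc c (laplacian G sc S x g))" for c x
    unfolding laplacian_def
    by (rule restrict_ext)
      (simp add: SG scale_right_diff_distrib scale_sum_right mult.commute)
  ultimately show ?thesis unfolding linear_cellular_automaton_def by blast
qed

lemma not_inj_on_laplacian:
  fixes G :: "('g, 'm) monoid_scheme" (structure)
    and sc :: "'k::field \<Rightarrow> 'v::ab_group_add \<Rightarrow> 'v" and v :: 'v
  assumes "group G" and "vector_space sc" and "S \<subseteq> carrier G" and "v \<noteq> 0"
  shows "\<not> inj_on (laplacian G sc S) (configs G UNIV)"
proof
  interpret group G by fact
  interpret vector_space sc by fact
  assume inj: "inj_on (laplacian G sc S) (configs G UNIV)"
  \<comment> \<open>Written as a sum over \<open>S\<close>, the first term of the Laplacian cancels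
    against the second on constants.\<close>
  have const: "sc (of_nat n) w = (\<Sum>s\<in>A. w)" if "n = card A" for n w and A :: "'g set"
    using that by (simp add: sum_constant_scale)
  have kill: "laplacian G sc S (\<lambda>g\<in>carrier G. w) = (\<lambda>g\<in>carrier G. 0)" for w
    unfolding laplacian_def
  proof (rule restrict_ext)
    fix g assume g: "g \<in> carrier G"
    have "(\<Sum>s\<in>S. (\<lambda>g\<in>carrier G. w) (g \<otimes> s)) = (\<Sum>s\<in>S. w)"
      using g assms(3) by (intro sum.cong) auto
    then show "sc (of_nat (card S)) ((\<lambda>g\<in>carrier G. w) g) - (\<Sum>s\<in>S. (\<lambda>g\<in>carrier G. w) (g \<otimes> s)) = 0"
      using g const[OF refl, of S w] by simp
  qed
  have "(\<lambda>g\<in>carrier G. v) = (\<lambda>g\<in>carrier G. 0)"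
    using inj_onD[OF inj, of "\<lambda>g\<in>carrier G. v" "\<lambda>g\<in>carrier G. 0"]
    by (simp add: kill configs_def)
  then have "v = 0" by (metis one_closed restrict_apply')
  with \<open>v \<noteq> 0\<close> show False by blast
qed

section \<open>The maximum principle for finitely supported functions\<close>

text \<open>The nonnegative differences \<open>c - f s\<close> have sum at most 0, so each
  vanishes.\<close>

lemma sum_eq_bound_imp_eq:
  fixes f :: "'a \<Rightarrow> real"
  assumes "finite S" and "\<And>s. s \<in> S \<Longrightarrow> f s \<le> c" and "real (card S) * c \<le> sum f S" and "s \<in> S"
  shows "f s = c"
proof -
  have "(\<Sum>s\<in>S. c - f s) = 0"
    using assms sum_nonneg[of S "\<lambda>s. c - f s"] by (simp add: sum_subtractf)
  then show ?thesis
    using assms sum_nonneg_eq_0_iff[of S "\<lambda>s. c - f s"] by simp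
qed

text \<open>The maximum principle: the set where the norm of \<open>p\<close> is maximal is stable under right
  translation by \<open>s\<^sup>-\<^sup>1\<close>; being finite, it is also stable under right translation by \<open>s\<close>, and so it
  contains a coset of the infinite subgroup generated by \<open>S\<close>.\<close>

lemma finite_support_harmonic_imp_zero:
  fixes G :: "('g, 'm) monoid_scheme" (structure)
    and p :: "'g \<Rightarrow> 'k::real_normed_field"
  assumes "group G" and "finite S" and SG: "S \<subseteq> carrier G" and inf: "infinite (generate G S)"
    and supp: "finite {g. p g \<noteq> 0}" "{g. p g \<noteq> 0} \<subseteq> carrier G"
    and harm: "\<And>g. g \<in> carrier G \<Longrightarrow>
      of_nat (card S) * p g - (\<Sum>s\<in>S. p (g \<otimes> inv s)) = 0"
  shows "p = 0"
proof (rule ccontr)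
  interpret group G by fact
  assume "p \<noteq> 0"
  then have ne: "{g. p g \<noteq> 0} \<noteq> {}" by (auto simp: fun_eq_iff)
  define m where "m = Max ((\<lambda>g. norm (p g)) ` {g. p g \<noteq> 0})"
  have "m \<in> (\<lambda>g. norm (p g)) ` {g. p g \<noteq> 0}"
    unfolding m_def using supp(1) ne by (intro Max_in) auto
  then obtain g0 where g0: "p g0 \<noteq> 0" "norm (p g0) = m" by auto
  then have mpos: "m > 0" by auto
  have le: "norm (p g) \<le> m" for g
  proof (cases "p g = 0")
    case False
    then show ?thesis unfolding m_def using supp(1) by (intro Max_ge) auto
  qed (use mpos in simp)
  define E where "E = {g. norm (p g) = m}"
  \<comment> \<open>Positivity of \<open>m\<close> places \<open>E\<close> inside the finite
    support.\<close>
  have E_sub: "E \<subseteq> {g. p g \<noteq> 0}" unfolding E_def using mpos by auto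
  have finE: "finite E" using E_sub supp(1) finite_subset by blast
  have EG: "E \<subseteq> carrier G" using E_sub supp(2) by blast
  have g0E: "g0 \<in> E" using g0 by (simp add: E_def)
  have inv_stable: "g \<otimes> inv s \<in> E" if "g \<in> E" "s \<in> S" for g s
  proof -
    \<comment> \<open>Harmonicity and the triangle inequality bound \<open>card S * m\<close> by a
      sum of \<open>card S\<close> norms, each at most \<open>m\<close>; all of them must equal
      \<open>m\<close>.\<close>
    have "real (card S) * m = norm (of_nat (card S) * p g)"
      using that by (simp add: norm_mult E_def)
    also have "\<dots> = norm (\<Sum>s\<in>S. p (g \<otimes> inv s))" using harm[of g] that EG by auto
    also have "\<dots> \<le> (\<Sum>s\<in>S. norm (p (g \<otimes> inv s)))" by (rule norm_sum)
    finally show ?thesis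
      unfolding E_def
      using sum_eq_bound_imp_eq[of S "\<lambda>s. norm (p (g \<otimes> inv s))" m s] assms(2) le that(2) by simp
  qed
  have stable: "g \<otimes> s \<in> E" if "g \<in> E" "s \<in> S" for g s
  proof -
    have s: "s \<in> carrier G" using that SG by blast
    have "inj_on (\<lambda>g. g \<otimes> inv s) E" using EG s by (intro inj_onI) (auto simp: subset_iff)
    moreover have "(\<lambda>g. g \<otimes> inv s) ` E \<subseteq> E" using inv_stable that by blast
    ultimately have "(\<lambda>g. g \<otimes> inv s) ` E = E" using finE by (simp add: endo_inj_surj)
    then have "g \<in> (\<lambda>g. g \<otimes> inv s) ` E" using that(1) by simp
    then obtain g' where "g' \<in> E" "g = g' \<otimes> inv s" by auto
    then show ?thesis using s EG by (auto simp: m_assoc subset_iff)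
  qed
  \<comment> \<open>Both stability facts enter, since \<open>generate\<close> is built from
    generators and their inverses.\<close>
  have gen: "\<forall>g\<in>E. g \<otimes> h \<in> E" if "h \<in> generate G S" for h
    using that
  proof (induction rule: generate.induct)
    case (eng h1 h2)
    have "h1 \<in> carrier G" "h2 \<in> carrier G"
      using eng.hyps generate_in_carrier[OF SG] by simp_all
    then have "g \<otimes> (h1 \<otimes> h2) = g \<otimes> h1 \<otimes> h2" if "g \<in> E" for g
      using that EG by (simp add: m_assoc subset_iff)
    then show ?case using eng.IH by simp
  qed (use EG stable inv_stable in auto)
  have "inj_on (\<lambda>h. g0 \<otimes> h) (generate G S)"
    using g0E EG generate_in_carrier[OF SG] by (intro inj_onI) (auto simp: subset_iff)
  moreover have "(\<lambda>h. g0 \<otimes> h) ` generate G S \<subseteq> E" using gen g0E by blast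
  ultimately show False using inf finE by (meson finite_imageD finite_subset)
qed

section \<open>Surjectivity of the Laplacian by transposition\<close>

text \<open>With \<open>D\<close> the transpose, \<open>L\<close> a left inverse of \<open>D\<close>
  on \<open>W\<close> and <p, y> the finite sum of \<open>sc (p a) (y a)\<close>, put x(g) = <L
  \<delta>_g, y>. Then the Laplacian of x at g is <L (D \<delta>_g), y> = <\<delta>_g, y> =
  y(g).\<close>

lemma surj_laplacian:
  fixes G :: "('g, 'm) monoid_scheme" (structure)
    and sc :: "'k::real_normed_field \<Rightarrow> 'v::ab_group_add \<Rightarrow> 'v"
  assumes "group G" and "vector_space sc"
    and S: "finite S" "S \<subseteq> carrier G" "infinite (generate G S)"
  shows "laplacian G sc S ` configs G UNIV = configs G UNIV"
proof
  show "laplacian G sc S ` configs G UNIV \<subseteq> configs G UNIV"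
    by (auto simp: laplacian_def configs_def)
  interpret group G by fact
  interpret V: vector_space sc by fact
  interpret F: vector_space "\<lambda>c (f::'g \<Rightarrow> 'k) x. c * f x"
    by (rule vector_space_fun) (simp add: vector_space_def algebra_simps)
  interpret P: vector_space_pair "\<lambda>c (f::'g \<Rightarrow> 'k) x. c * f x" "\<lambda>c (f::'g \<Rightarrow> 'k) x. c * f x"
    by unfold_locales
  define n :: 'k where "n = of_nat (card S)"
  define D where "D p = (\<lambda>g. if g \<in> carrier G then n * p g - (\<Sum>s\<in>S. p (g \<otimes> inv s)) else 0)"
    for p :: "'g \<Rightarrow> 'k"
  define W where "W = {p :: 'g \<Rightarrow> 'k. finite {g. p g \<noteq> 0} \<and> {g. p g \<noteq> 0} \<subseteq> carrier G}"
  have D: "Vector_Spaces.linear (\<lambda>c f x. c * f x) (\<lambda>c f x. c * f x) D"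
    by unfold_locales
      (auto simp: D_def fun_eq_iff sum.distrib algebra_simps sum_distrib_left)
  have W: "F.subspace W"
    unfolding F.subspace_def
  proof (intro conjI ballI allI)
    fix p q assume "p \<in> W" "q \<in> W"
    moreover have "{g. (p + q) g \<noteq> 0} \<subseteq> {g. p g \<noteq> 0} \<union> {g. q g \<noteq> 0}" by auto
    ultimately show "p + q \<in> W"
      unfolding W_def by (auto intro: finite_subset)
  qed (auto simp: W_def)
  \<comment> \<open>The maximum principle enters here, and with it the norm on the scalars and the
    infinite subgroup.\<close>
  have "inj_on D W"
    unfolding P.linear_inj_on_iff_eq_0[OF D W]
  proof (intro ballI impI)
    fix p assume p: "p \<in> W" "D p = 0"
    show "p = 0"
    proof (rule finite_support_harmonic_imp_zero[OF \<open>group G\<close> S])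
      show "of_nat (card S) * p g - (\<Sum>s\<in>S. p (g \<otimes> inv s)) = 0" if "g \<in> carrier G" for g
        using fun_cong[OF p(2), of g] that by (simp add: D_def n_def)
    qed (use p(1) in \<open>auto simp: W_def\<close>)
  qed
  \<comment> \<open>The range condition makes every \<open>L p\<close> finitely supported, so that
    it can be paired with an arbitrary configuration.\<close>
  then obtain L where L: "range L \<subseteq> W" "Vector_Spaces.linear (\<lambda>c f x. c * f x) (\<lambda>c f x. c * f x) L"
    "\<And>p. p \<in> W \<Longrightarrow> L (D p) = p"
    using P.linear_exists_left_inverse_on[OF D W] by blast
  define \<delta> where "\<delta> g = (\<lambda>h. if h = g then 1 else 0 :: 'k)" for g :: 'g
  have \<delta>W: "\<delta> g \<in> W" if "g \<in> carrier G" for g using that by (auto simp: W_def \<delta>_def)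
  have D\<delta>: "D (\<delta> g) = (\<lambda>h. n * \<delta> g h) - (\<Sum>s\<in>S. \<delta> (g \<otimes> s))" if g: "g \<in> carrier G" for g
  proof
    fix h
    \<comment> \<open>Both sides test \<open>h = g \<otimes> s\<close>; the inverses in
      \<open>D\<close> thus become the translations \<open>g \<otimes> s\<close> of the
      Laplacian.\<close>
    have eq: "\<delta> g (h \<otimes> inv s) = \<delta> (g \<otimes> s) h" if "s \<in> S" "h \<in> carrier G" for s
    proof -
      have "s \<in> carrier G" using that S by blast
      then show ?thesis using g that by (auto simp: \<delta>_def m_assoc)
    qed
    show "D (\<delta> g) h = ((\<lambda>h. n * \<delta> g h) - (\<Sum>s\<in>S. \<delta> (g \<otimes> s))) h"
    proof (cases "h \<in> carrier G")
      case True
      then show ?thesis using eq by (simp add: D_def sum_fun_apply cong: sum.cong)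
    next
      case False
      then have "h \<noteq> g" "\<And>s. s \<in> S \<Longrightarrow> h \<noteq> g \<otimes> s" using g S(2) by auto
      then show ?thesis using False by (simp add: D_def sum_fun_apply \<delta>_def)
    qed
  qed
  show "configs G UNIV \<subseteq> laplacian G sc S ` configs G UNIV"
  proof
    fix y assume y: "y \<in> configs G (UNIV :: 'v set)"
    \<comment> \<open>Pairing scalar functions with the V-valued \<open>y\<close> avoids any dual of
      V.\<close>
    define \<psi> where "\<psi> p = (\<Sum>g | p g \<noteq> 0. sc (p g) (y g))" for p
    have \<psi>_eq: "\<psi> p = (\<Sum>g\<in>A. sc (p g) (y g))" if "finite A" "{g. p g \<noteq> 0} \<subseteq> A" for p A
      unfolding \<psi>_def using that by (intro sum.mono_neutral_left) auto
    define x where "x = (\<lambda>g\<in>carrier G. \<psi> (L (\<delta> g)))"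
    have "laplacian G sc S x g = y g" if g: "g \<in> carrier G" for g
    proof -
      have gS: "g \<otimes> s \<in> carrier G" if "s \<in> S" for s using g that S(2) by blast
      \<comment> \<open>A common finite index set for all the pairings allows the sums to be
        exchanged; \<open>g\<close> is included so that the final sum against
        \<open>\<delta> g\<close> catches \<open>y g\<close>.\<close>
      define A where
        "A = insert g ({a. L (\<delta> g) a \<noteq> 0} \<union> (\<Union>s\<in>S. {a. L (\<delta> (g \<otimes> s)) a \<noteq> 0}))"
      have finL: "finite {a. L p a \<noteq> 0}" for p using L(1) by (auto simp: W_def)
      have finA: "finite A" unfolding A_def using finL S(1) by auto
      have L\<delta>: "\<delta> g a = n * L (\<delta> g) a - (\<Sum>s\<in>S. L (\<delta> (g \<otimes> s)) a)" for a
      proof -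
        have "\<delta> g = L (D (\<delta> g))" using L(3)[OF \<delta>W[OF g]] by simp
        also have "\<dots> = (\<lambda>a. n * L (\<delta> g) a) - (\<Sum>s\<in>S. L (\<delta> (g \<otimes> s)))"
          unfolding D\<delta>[OF g]
          by (simp add: P.linear_diff[OF L(2)] P.linear_scale[OF L(2)] P.linear_sum[OF L(2)])
        finally show ?thesis by (simp add: sum_fun_apply fun_eq_iff)
      qed
      have "laplacian G sc S x g = sc n (\<psi> (L (\<delta> g))) - (\<Sum>s\<in>S. \<psi> (L (\<delta> (g \<otimes> s))))"
        using g gS by (simp add: laplacian_def x_def n_def)
      also have "\<psi> (L (\<delta> g)) = (\<Sum>a\<in>A. sc (L (\<delta> g) a) (y a))"
        by (rule \<psi>_eq[OF finA]) (auto simp: A_def)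
      also have "(\<Sum>s\<in>S. \<psi> (L (\<delta> (g \<otimes> s)))) = (\<Sum>s\<in>S. \<Sum>a\<in>A. sc (L (\<delta> (g \<otimes> s)) a) (y a))"
        by (intro sum.cong refl \<psi>_eq[OF finA]) (auto simp: A_def)
      also have "\<dots> = (\<Sum>a\<in>A. sc (\<Sum>s\<in>S. L (\<delta> (g \<otimes> s)) a) (y a))"
        by (subst sum.swap) (simp add: V.scale_sum_left)
      also have "sc n (\<Sum>a\<in>A. sc (L (\<delta> g) a) (y a)) - \<dots> = (\<Sum>a\<in>A. sc (\<delta> g a) (y a))"
        by (simp add: L\<delta> V.scale_sum_right V.scale_left_diff_distrib sum_subtractf)
      also have "\<dots> = (\<Sum>a\<in>{g}. sc (\<delta> g a) (y a))"
        using finA by (intro sum.mono_neutral_right) (auto simp: A_def \<delta>_def)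
      also have "\<dots> = y g" by (simp add: \<delta>_def)
      finally show ?thesis .
    qed
    moreover have "laplacian G sc S x \<in> configs G UNIV"
      by (auto simp: laplacian_def configs_def)
    ultimately have "laplacian G sc S x = y"
      using y unfolding configs_def by (intro PiE_ext[of _ "carrier G" "\<lambda>_. UNIV"]) auto
    moreover have "x \<in> configs G UNIV" by (auto simp: x_def configs_def)
    ultimately show "y \<in> laplacian G sc S ` configs G UNIV" by blast
  qed
qed

section \<open>The equivalence over normed fields\<close>

text \<open>The class \<open>real_normed_field\<close> contains both the reals and the complex
  numbers, so one proof serves both cases. If local finiteness fails, the Laplacian of a finite set
  generating an infinite subgroup is the counterexample.\<close>

lemma locally_finite_iff_surj_imp_inj:
  fixes sc :: "'k::real_normed_field \<Rightarrow> 'v::ab_group_add \<Rightarrow> 'v"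
  assumes "group G" and "v \<noteq> (0::'v)" and fd: "finite_dimensional_vector_space sc B"
  shows "locally_finite G \<longleftrightarrow>
    (\<forall>\<tau>. linear_cellular_automaton G sc \<tau> \<and> \<tau> ` configs G UNIV = configs G UNIV \<longrightarrow>
         inj_on \<tau> (configs G UNIV))"
proof
  interpret finite_dimensional_vector_space sc B by fact
  have vs: "vector_space sc" by unfold_locales
  assume inj: "\<forall>\<tau>. linear_cellular_automaton G sc \<tau> \<and> \<tau> ` configs G UNIV = configs G UNIV \<longrightarrow>
         inj_on \<tau> (configs G UNIV)"
  show "locally_finite G"
  proof (rule ccontr)
    assume "\<not> locally_finite G"
    then obtain H S where H: "subgroup H G" "infinite H" "finite S" "S \<subseteq> H" "generate G S = H"
      unfolding locally_finite_def by blast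
    then have S: "S \<subseteq> carrier G" "infinite (generate G S)"
      using subgroup.subset[OF H(1)] by auto
    show False
      using inj linear_cellular_automaton_laplacian[OF assms(1) vs H(3) S(1)]
        surj_laplacian[OF assms(1) vs H(3) S] not_inj_on_laplacian[OF assms(1) vs S(1) assms(2)]
      by blast
  qed
qed (use surj_linear_cellular_automaton_inj[OF assms(1) fd] in blast)

theorem theorem1p1:
  fixes G :: "('g, 'm) monoid_scheme"
    and scR :: "real \<Rightarrow> 'v::ab_group_add \<Rightarrow> 'v"
    and scC :: "complex \<Rightarrow> 'v \<Rightarrow> 'v"
  assumes "group G"
    and "\<exists>v::'v. v \<noteq> 0"
  shows "((\<exists>B. finite_dimensional_vector_space scR B) \<longrightarrow>
            (locally_finite G \<longleftrightarrow>
               (\<forall>\<tau>. linear_cellular_automaton G scR \<tau> \<and> \<tau> ` configs G UNIV = configs G UNIV \<longrightarrow>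
                    inj_on \<tau> (configs G UNIV)))) \<and>
         ((\<exists>B. finite_dimensional_vector_space scC B) \<longrightarrow>
            (locally_finite G \<longleftrightarrow>
               (\<forall>\<tau>. linear_cellular_automaton G scC \<tau> \<and> \<tau> ` configs G UNIV = configs G UNIV \<longrightarrow>
                    inj_on \<tau> (configs G UNIV))))"
proof -
  obtain v :: 'v where "v \<noteq> 0" using assms(2) by blast
  note iff = locally_finite_iff_surj_imp_inj[OF assms(1) this]
  show ?thesis by (intro conjI impI; elim exE; rule iff)
qed

end
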